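(* As formal power series in $y$, \[ \sum_{n\ge 0}R_n(x)y^n = \frac{1+(1+x)y-(x+x^2)y^3-(x +x^2)y^4+x^2y^6}{1-(1+x+x^2)y^2+x^2y^4}. \]
   Context: For $n\ge 0$, the $S$-fence $\phi_n$ is the poset on $\{x_1,\dots,x_n\}$ whose order is generated by the cover relations $x_2<x_1$, $x_3<x_2$, $x_2<x_4$, $x_5<x_4$, and, for every $i\ge 3$, $x_{2i-1}<x_{2i}$ and $x_{2i+1}<x_{2i}$, keeping only those relations whose elements both have index $\le n$ ($\phi_0$ is empty). A filter is an up-set. $\mathcal{F}(\phi_n)$ is the set of filters of $\phi_n$ ordered by reverse inclusion; the rank of a filter $Y$ is $n-|Y|$. $r_{n,k}$ is the number of elements of rank $k$ in $\mathcal{F}(\phi_n)$ and $R_n(x)=\sum_{k\ge0}r_{n,k}x^k$. *)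

theory Defs
  imports "HOL-Computational_Algebra.Computational_Algebra"
begin

text \<open>
  The element \<open>x\<^sub>i\<close> of the S-fence is represented by its index \<open>i\<close>.
  A pair \<open>(a, b)\<close> stands for \<open>x\<^sub>a < x\<^sub>b\<close>.
\<close>

definition fence_covers :: "(nat \<times> nat) set" where
  "fence_covers = {(2, 1), (3, 2), (2, 4), (5, 4)}
     \<union> (\<Union>i\<in>{3..}. {(2 * i - 1, 2 * i), (2 * i + 1, 2 * i)})"

definition fence_elems :: "nat \<Rightarrow> nat set" where
  "fence_elems n = {1..n}"

definition fence_order :: "nat \<Rightarrow> (nat \<times> nat) set" where
  "fence_order n =
     Id_on (fence_elems n) \<union> (fence_covers \<inter> fence_elems n \<times> fence_elems n)\<^sup>+"

lemma partial_order_on_fence: "partial_order_on (fence_elems n) (fence_order n)"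
proof -
  let ?C = "fence_covers \<inter> fence_elems n \<times> fence_elems n"
  define h :: "nat \<Rightarrow> nat" where
    "h j = (if j = 2 then 1 else if j = 1 \<or> even j then 2 else 0)" for j
  have step: "h a < h b" if "(a, b) \<in> ?C" for a b
    using that by (auto simp: fence_covers_def h_def; presburger)
  have h: "h a < h b" if "(a, b) \<in> ?C\<^sup>+" for a b
    using that by (induction rule: trancl_induct) (use step less_trans in blast)+
  have sub: "?C\<^sup>+ \<subseteq> fence_elems n \<times> fence_elems n"
    by (rule trancl_subset_Sigma) auto
  have "refl_on (fence_elems n) (fence_order n)"
    using sub by (auto simp: fence_order_def refl_on_def)
  moreover have "fence_order n \<subseteq> fence_elems n \<times> fence_elems n"
    using sub by (auto simp: fence_order_def)
  moreover have "trans (fence_order n)"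
    unfolding fence_order_def trans_def by (auto intro: trancl_trans)
  moreover have "antisym (fence_order n)"
    unfolding fence_order_def antisym_def by (auto dest!: h)
  ultimately show ?thesis
    by (simp add: partial_order_on_def preorder_on_def)
qed

definition up_sets :: "'a set \<Rightarrow> ('a \<times> 'a) set \<Rightarrow> 'a set set" where
  "up_sets A r = {Y. Y \<subseteq> A \<and> (\<forall>a\<in>Y. \<forall>b. (a, b) \<in> r \<longrightarrow> b \<in> Y)}"

definition fence_filters :: "nat \<Rightarrow> nat set set" where
  "fence_filters n = up_sets (fence_elems n) (fence_order n)"

text \<open>
  Filters are ordered by reverse inclusion, so the whole fence is the least element, of rank \<open>0\<close>.
\<close>

definition filter_rank :: "nat \<Rightarrow> nat set \<Rightarrow> nat" where
  "filter_rank n Y = n - card Y"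

definition rank_number :: "nat \<Rightarrow> nat \<Rightarrow> nat" where
  "rank_number n k = card {Y \<in> fence_filters n. filter_rank n Y = k}"

text \<open>No filter has rank above \<open>n\<close>, so the sum over all \<open>k\<close> stops at \<open>n\<close>.\<close>

definition rank_poly :: "nat \<Rightarrow> int poly" where
  "rank_poly n = (\<Sum>k\<le>n. monom (int (rank_number n k)) k)"

end

theory Submission
  imports Defs
begin

text \<open>
  Sort the filters of \<open>\<phi>\<^sub>n\<close> by whether they contain \<open>x\<^sub>n\<close>. Since \<open>x\<^sub>n\<close> is extremal in the fence,
  both classes are copies of the filters of a shorter fence, which gives
  \<open>R\<^sub>n = R\<^sub>p + x\<^bsup>n-q\<^esup> R\<^sub>q\<close> with \<open>(p, q) = (n - 2, n - 1)\<close> for odd \<open>n \<ge> 5\<close> and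
  \<open>(p, q) = (n - 1, n - 2)\<close> for even \<open>n \<ge> 6\<close>. Eliminating one parity yields
  \<open>R\<^sub>n = (1 + x + x\<^sup>2) R\<^bsub>n-2\<^esub> - x\<^sup>2 R\<^bsub>n-4\<^esub>\<close> for \<open>n \<ge> 7\<close>, and the numerator
  collects the initial values.
\<close>

section \<open>Filters described by cover relations\<close>

text \<open>Replaces the indexed union by parity and size conditions, so that later questions about
  covers become linear arithmetic.\<close>

lemma fence_covers_iff:
  "(a, b) \<in> fence_covers \<longleftrightarrow>
     (a, b) \<in> {(2, 1), (3, 2), (2, 4), (5, 4)} \<or> even b \<and> 6 \<le> b \<and> (b = Suc a \<or> a = Suc b)"
proof -
  have "(a, b) \<in> (\<Union>i\<in>{3..}. {(2 * i - 1, 2 * i), (2 * i + 1, 2 * i)}) \<longleftrightarrow>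
      (\<exists>i\<ge>3. a = 2 * i - 1 \<and> b = 2 * i \<or> a = 2 * i + 1 \<and> b = 2 * i)"
    by blast
  also have "\<dots> \<longleftrightarrow> even b \<and> 6 \<le> b \<and> (b = Suc a \<or> a = Suc b)"
    by presburger
  finally show ?thesis
    unfolding fence_covers_def by (simp only: Un_iff)
qed

text \<open>Membership propagates along a chain of covers by induction on the transitive closure, so
  closure under the generating covers inside \<open>{1..n}\<close> already gives closure under the
  whole order.\<close>

lemma fence_filters_iff:
  "Y \<in> fence_filters n \<longleftrightarrow>
     Y \<subseteq> {1..n} \<and> (\<forall>a\<in>Y. \<forall>b\<in>{1..n}. (a, b) \<in> fence_covers \<longrightarrow> b \<in> Y)"
    (is "_ \<longleftrightarrow> ?R")
proof
  assume Y: "Y \<in> fence_filters n"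
  have sub: "Y \<subseteq> {1..n}"
    using Y by (simp add: fence_filters_def up_sets_def fence_elems_def)
  have "b \<in> Y" if "a \<in> Y" "b \<in> {1..n}" "(a, b) \<in> fence_covers" for a b
  proof -
    have "(a, b) \<in> fence_covers \<inter> {1..n} \<times> {1..n}"
      using sub that by blast
    then have "(a, b) \<in> fence_order n"
      unfolding fence_order_def fence_elems_def by blast
    with Y \<open>a \<in> Y\<close> show ?thesis
      unfolding fence_filters_def up_sets_def by blast
  qed
  with sub show ?R
    by blast
next
  assume R: ?R
  have "b \<in> Y" if "(a, b) \<in> (fence_covers \<inter> {1..n} \<times> {1..n})\<^sup>+" "a \<in> Y" for a b
    using that by (induction rule: trancl_induct) (use R in blast)+
  with R show "Y \<in> fence_filters n"
    unfolding fence_filters_def up_sets_def fence_order_def fence_elems_def by blast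
qed

lemma fence_filters_subset: "Y \<in> fence_filters n \<Longrightarrow> Y \<subseteq> {1..n}"
  by (simp add: fence_filters_iff)

lemma fence_filtersD:
  assumes "Y \<in> fence_filters n" "a \<in> Y" "(a, b) \<in> fence_covers" "1 \<le> b" "b \<le> n"
  shows "b \<in> Y"
  using assms by (auto simp: fence_filters_iff)

lemma fence_filters_avoid_top:
  assumes "Y \<in> fence_filters n" "n \<notin> Y"
  shows "Y \<subseteq> {..n - 1}"
proof
  fix a assume "a \<in> Y"
  moreover from this have "a \<le> n"
    using fence_filters_subset[OF assms(1)] by auto
  ultimately have "a < n"
    using assms(2) by (cases "a = n") auto
  then show "a \<in> {..n - 1}" by auto
qed

lemma finite_fence_filters: "finite (fence_filters n)"
proof (rule finite_subset)
  show "fence_filters n \<subseteq> Pow {1..n}"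
    using fence_filters_subset by blast
qed simp

text \<open>Grouping the filters by rank turns the coefficient form into a weighted sum, which can
  be cut along any partition of the filters.\<close>

lemma rank_poly_eq_sum: "rank_poly n = (\<Sum>Y\<in>fence_filters n. monom 1 (n - card Y))"
proof -
  have "(\<Sum>Y\<in>fence_filters n. monom (1::int) (n - card Y)) =
      (\<Sum>k\<le>n. \<Sum>Y | Y \<in> fence_filters n \<and> filter_rank n Y = k. monom 1 (n - card Y))"
    by (rule sum.group[symmetric]) (auto simp: finite_fence_filters filter_rank_def)
  also have "\<dots> = (\<Sum>k\<le>n. \<Sum>Y | Y \<in> fence_filters n \<and> filter_rank n Y = k. monom 1 k)"
    by (intro sum.cong refl) (auto simp: filter_rank_def)
  also have "\<dots> = rank_poly n"
    by (simp add: rank_poly_def rank_number_def of_nat_poly smult_monom)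
  finally show ?thesis ..
qed

section \<open>Splitting the filters by the last element\<close>

text \<open>A filter with \<open>n\<close> must contain everything beyond \<open>p\<close>, and the
  part up to \<open>p\<close> is then free because no cover leads from beyond \<open>p\<close> back
  down. A filter without \<open>n\<close> lives in \<open>{..q}\<close>, and conversely no cover
  leads out of \<open>{..q}\<close>. All later recurrences are instances of this one.\<close>

lemma rank_poly_split:
  assumes "p < n" "q < n"
    and contains: "\<And>Y. Y \<in> fence_filters n \<Longrightarrow> n \<in> Y \<Longrightarrow> {p<..n} \<subseteq> Y"
    and no_cover_down: "\<And>a b. (a, b) \<in> fence_covers \<Longrightarrow> p < a \<Longrightarrow> a \<le> n \<Longrightarrow> 1 \<le> b \<Longrightarrow> b \<le> p \<Longrightarrow> False"
    and avoids: "\<And>Y. Y \<in> fence_filters n \<Longrightarrow> n \<notin> Y \<Longrightarrow> Y \<subseteq> {..q}"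
    and no_cover_up: "\<And>a b. (a, b) \<in> fence_covers \<Longrightarrow> a \<le> q \<Longrightarrow> q < b \<Longrightarrow> b \<le> n \<Longrightarrow> False"
  shows "rank_poly n = rank_poly p + monom 1 (n - q) * rank_poly q"
proof -
  let ?w = "\<lambda>Y::nat set. monom (1::int) (n - card Y)"
  let ?A = "{Y \<in> fence_filters n. n \<in> Y}" and ?B = "{Y \<in> fence_filters n. n \<notin> Y}"
  \<comment> \<open>Intersecting with \<open>{..p}\<close> undoes adjoining the block
    \<open>{p<..n}\<close>.\<close>
  have A: "?A = (\<lambda>Y. Y \<union> {p<..n}) ` fence_filters p"
  proof (intro equalityI subsetI)
    fix Y assume Y: "Y \<in> ?A"
    then have "{p<..n} \<subseteq> Y" "Y \<subseteq> {1..n}"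
      using contains fence_filters_subset by auto
    then have "Y = (Y \<inter> {..p}) \<union> {p<..n}"
      by auto
    moreover have "Y \<inter> {..p} \<in> fence_filters p"
      using Y \<open>p < n\<close> by (fastforce simp: fence_filters_iff)
    ultimately show "Y \<in> (\<lambda>Y. Y \<union> {p<..n}) ` fence_filters p"
      by blast
  next
    fix Z assume "Z \<in> (\<lambda>Y. Y \<union> {p<..n}) ` fence_filters p"
    then obtain Y where Y: "Y \<in> fence_filters p" and Z: "Z = Y \<union> {p<..n}"
      by blast
    have "b \<in> Z" if "a \<in> Z" "(a, b) \<in> fence_covers" "1 \<le> b" "b \<le> n" for a b
    proof (cases "b \<le> p")
      case True
      then have "a \<in> Y"
        using that no_cover_down[of a b] by (auto simp: Z)
      then show ?thesis
        using fence_filtersD[OF Y] that True by (simp add: Z)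
    qed (use that in \<open>auto simp: Z\<close>)
    then show "Z \<in> ?A"
      using fence_filters_subset[OF Y] \<open>p < n\<close> by (fastforce simp: fence_filters_iff Z)
  qed
  have B: "?B = fence_filters q"
  proof (intro equalityI subsetI)
    fix Y assume Y: "Y \<in> ?B"
    then have "Y \<subseteq> {..q}"
      using avoids by auto
    with Y \<open>q < n\<close> show "Y \<in> fence_filters q"
      by (fastforce simp: fence_filters_iff)
  next
    fix Y assume Y: "Y \<in> fence_filters q"
    have "b \<in> Y" if "a \<in> Y" "(a, b) \<in> fence_covers" "1 \<le> b" "b \<le> n" for a b
    proof -
      have "a \<le> q"
        using that fence_filters_subset[OF Y] by auto
      then have "b \<le> q"
        using that no_cover_up[of a b] by (meson not_le)
      then show ?thesis
        using fence_filtersD[OF Y] that by blast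
    qed
    then show "Y \<in> ?B"
      using fence_filters_subset[OF Y] \<open>q < n\<close> by (fastforce simp: fence_filters_iff)
  qed
  have card_le: "card Y \<le> m" and disj: "Y \<inter> {m<..n} = {}" and fin: "finite Y"
    if "Y \<in> fence_filters m" for Y m
    using fence_filters_subset[OF that] card_mono[of "{1..m}" Y] finite_subset[of Y "{1..m}"]
    by auto
  have inj: "inj_on (\<lambda>Y. Y \<union> {p<..n}) (fence_filters p)"
    using disj by (intro inj_onI) blast
  have "sum ?w ?A = (\<Sum>Y\<in>fence_filters p. ?w (Y \<union> {p<..n}))"
    unfolding A using inj by (simp add: sum.reindex)
  \<comment> \<open>The block adds \<open>n - p\<close> elements, so the rank in the long fence
    equals the rank in the short one.\<close>
  also have "\<dots> = rank_poly p"
    unfolding rank_poly_eq_sum using \<open>p < n\<close>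
    by (intro sum.cong refl) (simp add: card_Un_disjoint disj fin)
  finally have sA: "sum ?w ?A = rank_poly p" .
  \<comment> \<open>Here the rank grows by \<open>n - q\<close>; \<open>card_le\<close> keeps the
    truncated subtraction exact.\<close>
  have sB: "sum ?w ?B = monom 1 (n - q) * rank_poly q"
    unfolding rank_poly_eq_sum B sum_distrib_left mult_monom
    using \<open>q < n\<close> card_le by (intro sum.cong refl) simp
  have "rank_poly n = sum ?w (?A \<union> ?B)"
    unfolding rank_poly_eq_sum by (rule sum.cong) auto
  also have "\<dots> = sum ?w ?A + sum ?w ?B"
    by (rule sum.union_disjoint) (auto simp: finite_fence_filters)
  finally show ?thesis
    by (simp only: sA sB)
qed

section \<open>The fences with at most four elements\<close>

lemma rank_poly_0: "rank_poly 0 = 1"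
proof -
  have "fence_filters 0 = {{}}"
    by (auto simp: fence_filters_iff)
  then show ?thesis
    by (simp add: rank_poly_eq_sum)
qed

text \<open>For \<open>n\<close> from 1 to 3 the fence is a chain with \<open>n\<close> at the
  bottom: containing \<open>n\<close> forces the whole fence, hence \<open>p = 0\<close> and
  \<open>q = n - 1\<close>.\<close>

lemma rank_poly_1: "rank_poly 1 = rank_poly 0 + monom 1 1 * rank_poly 0"
proof -
  have *: "{0<..1} = {1::nat}" by auto
  have "rank_poly 1 = rank_poly 0 + monom 1 (1 - 0) * rank_poly 0"
  proof (rule rank_poly_split)
    fix Y assume Y: "Y \<in> fence_filters 1"
    show "{0<..1} \<subseteq> Y" if "1 \<in> Y"
      using that unfolding * by simp
    show "Y \<subseteq> {..0}" if "1 \<notin> Y"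
      using fence_filters_avoid_top[OF Y that] by simp
  qed (auto simp: fence_covers_iff)
  then show ?thesis by simp
qed

lemma rank_poly_2: "rank_poly 2 = rank_poly 0 + monom 1 1 * rank_poly 1"
proof -
  have *: "{0<..2} = {1, 2::nat}" by auto
  have "rank_poly 2 = rank_poly 0 + monom 1 (2 - 1) * rank_poly 1"
  proof (rule rank_poly_split)
    fix Y assume Y: "Y \<in> fence_filters 2"
    show "{0<..2} \<subseteq> Y" if "2 \<in> Y"
      using fence_filtersD[OF Y, of 2 1] that by (auto simp: fence_covers_iff *)
    show "Y \<subseteq> {..1}" if "2 \<notin> Y"
      using fence_filters_avoid_top[OF Y that] by simp
  qed (auto simp: fence_covers_iff)
  then show ?thesis by simp
qed

lemma rank_poly_3: "rank_poly 3 = rank_poly 0 + monom 1 1 * rank_poly 2"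
proof -
  have *: "{0<..3} = {1, 2, 3::nat}" by auto
  have "rank_poly 3 = rank_poly 0 + monom 1 (3 - 2) * rank_poly 2"
  proof (rule rank_poly_split)
    fix Y assume Y: "Y \<in> fence_filters 3"
    show "{0<..3} \<subseteq> Y" if "3 \<in> Y"
      using fence_filtersD[OF Y, of 3 2] fence_filtersD[OF Y, of 2 1] that
      by (auto simp: fence_covers_iff *)
    show "Y \<subseteq> {..2}" if "3 \<notin> Y"
      using fence_filters_avoid_top[OF Y that] by simp
  qed (auto simp: fence_covers_iff)
  then show ?thesis by simp
qed

text \<open>The element 4 is maximal and lies above the chain \<open>3 < 2\<close>, so omitting it
  also omits 2 and 3, and only 1 remains free.\<close>

lemma rank_poly_4: "rank_poly 4 = rank_poly 3 + monom 1 3 * rank_poly 1"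
proof -
  have *: "{3<..4} = {4::nat}" by auto
  have "rank_poly 4 = rank_poly 3 + monom 1 (4 - 1) * rank_poly 1"
  proof (rule rank_poly_split)
    fix Y assume Y: "Y \<in> fence_filters 4"
    show "{3<..4} \<subseteq> Y" if "4 \<in> Y"
      using that unfolding * by simp
    show "Y \<subseteq> {..1}" if "4 \<notin> Y"
    proof
      fix a assume a: "a \<in> Y"
      have "2 \<notin> Y"
        using fence_filtersD[OF Y, of 2 4] that by (auto simp: fence_covers_iff)
      moreover from this have "3 \<notin> Y"
        using fence_filtersD[OF Y, of 3 2] by (auto simp: fence_covers_iff)
      moreover have "a \<le> 4"
        using fence_filters_subset[OF Y] a by auto
      moreover consider "a \<le> 1" | "a = 2" | "a = 3" | "a = 4" | "a > 4"
        by linarith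
      ultimately show "a \<in> {..1}"
        using that a by cases auto
    qed
  qed (auto simp: fence_covers_iff)
  then show ?thesis by simp
qed

section \<open>Recurrences by parity\<close>

text \<open>An odd last element is minimal, and inside the fence its only cover is the maximal
  element \<open>n - 1\<close>, which it therefore drags into the filter.\<close>

lemma rank_poly_odd:
  assumes "odd n" "n \<ge> 5"
  shows "rank_poly n = rank_poly (n - 2) + monom 1 1 * rank_poly (n - 1)"
proof -
  have "rank_poly n = rank_poly (n - 2) + monom 1 (n - (n - 1)) * rank_poly (n - 1)"
  proof (rule rank_poly_split)
    have cover: "(n, n - 1) \<in> fence_covers"
      using assms unfolding fence_covers_iff by auto presburger+
    fix Y assume Y: "Y \<in> fence_filters n"
    show "{n - 2<..n} \<subseteq> Y" if "n \<in> Y"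
    proof
      fix a assume "a \<in> {n - 2<..n}"
      then have "a = n \<or> a = n - 1" by auto
      then show "a \<in> Y"
        using fence_filtersD[OF Y that cover] that \<open>n \<ge> 5\<close> by auto
    qed
    show "Y \<subseteq> {..n - 1}" if "n \<notin> Y"
      using fence_filters_avoid_top[OF Y that] by simp
  next
    fix a b assume "(a, b) \<in> fence_covers" "n - 2 < a" "a \<le> n" "1 \<le> b" "b \<le> n - 2"
    \<comment> \<open>The element \<open>n - 1\<close> is maximal, and the covers of
      \<open>n\<close> are \<open>n - 1\<close> and \<open>n + 1\<close>, neither of which is at
      most \<open>n - 2\<close>.\<close>
    moreover from this have "a = n \<or> a = n - 1" by auto
    ultimately show False
      using assms by (auto simp: fence_covers_iff; presburger)
  next
    fix a b assume "(a, b) \<in> fence_covers" "a \<le> n - 1" "n - 1 < b" "b \<le> n"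
    moreover from this have "b = n" by auto
    ultimately show False
      using assms by (auto simp: fence_covers_iff)
  qed (use assms in auto)
  then show ?thesis
    using assms by simp
qed

text \<open>An even last element is maximal, and inside the fence only \<open>n - 1\<close> lies
  below it, so omitting \<open>n\<close> omits exactly one further element. This fails at
  \<open>n = 4\<close>, where a chain of two lies below.\<close>

lemma rank_poly_even:
  assumes "even n" "n \<ge> 6"
  shows "rank_poly n = rank_poly (n - 1) + monom 1 2 * rank_poly (n - 2)"
proof -
  have "rank_poly n = rank_poly (n - 1) + monom 1 (n - (n - 2)) * rank_poly (n - 2)"
  proof (rule rank_poly_split)
    have cover: "(n - 1, n) \<in> fence_covers"
      using assms by (auto simp: fence_covers_iff)
    fix Y assume Y: "Y \<in> fence_filters n"
    show "{n - 1<..n} \<subseteq> Y" if "n \<in> Y"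
    proof
      fix a assume "a \<in> {n - 1<..n}"
      then have "a = n" by auto
      with that show "a \<in> Y" by simp
    qed
    show "Y \<subseteq> {..n - 2}" if "n \<notin> Y"
    proof
      fix a assume a: "a \<in> Y"
      have "n - 1 \<notin> Y"
        using fence_filtersD[OF Y _ cover] that \<open>n \<ge> 6\<close> by auto
      then have "a \<noteq> n - 1" "a \<noteq> n" "a \<le> n"
        using a that fence_filters_subset[OF Y] by auto
      then show "a \<in> {..n - 2}" by auto
    qed
  next
    fix a b assume "(a, b) \<in> fence_covers" "n - 1 < a" "a \<le> n" "1 \<le> b" "b \<le> n - 1"
    moreover from this have "a = n" by auto
    ultimately show False
      using assms by (auto simp: fence_covers_iff)
  next
    fix a b assume "(a, b) \<in> fence_covers" "a \<le> n - 2" "n - 2 < b" "b \<le> n"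
    moreover from this have "b = n \<or> b = n - 1" by auto
    ultimately show False
      using assms by (auto simp: fence_covers_iff; presburger)
  qed (use assms in auto)
  then show ?thesis
    using assms by simp
qed

text \<open>Three consecutive parity recurrences allow the neighbours \<open>n - 1\<close> and
  \<open>n - 3\<close> of opposite parity to be eliminated; both parities give the same
  result.\<close>

lemma rank_poly_rec:
  assumes "n \<ge> 7"
  shows "rank_poly n =
    (1 + monom 1 1 + monom 1 2) * rank_poly (n - 2) - monom 1 2 * rank_poly (n - 4)"
proof -
  have m: "monom (1::int) 2 = monom 1 1 * monom 1 1"
    by (simp add: mult_monom numeral_2_eq_2)
  have n: "n - 1 - 1 = n - 2" "n - 1 - 2 = n - 3" "n - 2 - 1 = n - 3" "n - 2 - 2 = n - 4"
    by auto
  show ?thesis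
  proof (cases "even n")
    case True
    \<comment> \<open>The even recurrence is also used at \<open>n - 2\<close>, which must be at
      least 6.\<close>
    with assms have "n \<ge> 8" by presburger
    with True have "rank_poly n = rank_poly (n - 1) + monom 1 2 * rank_poly (n - 2)"
      "rank_poly (n - 1) = rank_poly (n - 3) + monom 1 1 * rank_poly (n - 2)"
      "rank_poly (n - 2) = rank_poly (n - 3) + monom 1 2 * rank_poly (n - 4)"
      using rank_poly_even[of n] rank_poly_odd[of "n - 1", unfolded n]
        rank_poly_even[of "n - 2", unfolded n] by simp_all
    then show ?thesis
      by algebra
  next
    case False
    with assms have "rank_poly n = rank_poly (n - 2) + monom 1 1 * rank_poly (n - 1)"
      "rank_poly (n - 1) = rank_poly (n - 2) + monom 1 2 * rank_poly (n - 3)"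
      "rank_poly (n - 2) = rank_poly (n - 4) + monom 1 1 * rank_poly (n - 3)"
      using rank_poly_odd[of n] rank_poly_even[of "n - 1", unfolded n]
        rank_poly_odd[of "n - 2", unfolded n] by simp_all
    then show ?thesis
      unfolding m by algebra
  qed
qed

section \<open>The generating function\<close>

theorem theorem3:
  shows "Abs_fps (\<lambda>n. to_fract (rank_poly n)) =
    (let x = fps_const (to_fract [:0, 1:]);
         y = fps_X :: int poly fract fps
     in (1 + (1 + x) * y - (x + x^2) * y^3 - (x + x^2) * y^4 + x^2 * y^6)
        / (1 - (1 + x + x^2) * y^2 + x^2 * y^4))"
proof -
  define X where "X = to_fract [:0, 1::int:]"
  define r where "r n = to_fract (rank_poly n)" for n
  define F where "F = Abs_fps (\<lambda>n. to_fract (rank_poly n))"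
  \<comment> \<open>Each coefficient sits in a single \<open>fps_const\<close>, so that the
    coefficients of \<open>N\<close> and \<open>F * D\<close> can be read off directly.\<close>
  define N where "N = 1 + fps_const (1 + X) * fps_X - fps_const (X + X^2) * fps_X ^ 3
    - fps_const (X + X^2) * fps_X ^ 4 + fps_const (X^2) * fps_X ^ 6"
  define D where "D = 1 - fps_const (1 + X + X^2) * fps_X ^ 2 + fps_const (X^2) * fps_X ^ 4"
  have X: "to_fract (monom 1 k) = X ^ k" for k
  proof (induction k)
    case (Suc k)
    have "monom 1 (Suc k) = [:0, 1::int:] * monom 1 k"
      by (simp add: monom_Suc)
    then show ?case
      by (simp only: to_fract_mult Suc power_Suc X_def)
  qed simp
  note to_r = r_def X to_fract_add to_fract_mult to_fract_diff power_one_right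
  have r0: "r 0 = 1"
    by (simp add: r_def rank_poly_0)
  have r1: "r 1 = r 0 + X * r 0" and r2: "r 2 = r 0 + X * r 1"
    and r3: "r 3 = r 0 + X * r 2" and r4: "r 4 = r 3 + X ^ 3 * r 1"
    by (simp_all only: to_r rank_poly_1 rank_poly_2 rank_poly_3 rank_poly_4)
  have r5: "r 5 = r 3 + X * r 4"
    using rank_poly_odd[of 5] by (simp only: to_r) (simp add: to_r)
  have r6: "r 6 = r 5 + X ^ 2 * r 4"
    using rank_poly_even[of 6] by (simp only: to_r) (simp add: to_r)
  have rec: "r n = (1 + X + X ^ 2) * r (n - 2) - X ^ 2 * r (n - 4)" if "n \<ge> 7" for n
    unfolding r_def rank_poly_rec[OF that] by (simp only: to_r to_fract_1)
  have "F * D = N"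
  proof (rule fps_ext)
    fix n
    have FD: "F * D = F - fps_const (1 + X + X^2) * (F * fps_X ^ 2)
        + fps_const (X^2) * (F * fps_X ^ 4)"
      unfolding D_def by algebra
    \<comment> \<open>Multiplying by a power of \<open>fps_X\<close> shifts the sequence; terms with
      negative index become 0.\<close>
    have L: "(F * D) $ n = r n - (1 + X + X^2) * (if n < 2 then 0 else r (n - 2))
        + X^2 * (if n < 4 then 0 else r (n - 4))"
      unfolding FD by (simp add: F_def r_def fps_X_power_mult_right_nth del: fps_const_add fps_const_power)
    have R: "N $ n = (if n = 0 then 1 else 0) + (1 + X) * (if n = 1 then 1 else 0)
        - (X + X^2) * (if n = 3 then 1 else 0)
        - (X + X^2) * (if n = 4 then 1 else 0) + X^2 * (if n = 6 then 1 else 0)"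
      unfolding N_def by (simp add: fps_X_power_nth del: fps_const_add fps_const_power)
    \<comment> \<open>From 7 on, the recurrence makes the coefficient vanish, as it does in
      \<open>N\<close>, which has degree 6; below 7 the initial values are compared one by
      one.\<close>
    consider "n = 0" | "n = 1" | "n = 2" | "n = 3" | "n = 4" | "n = 5" | "n = 6" | "n \<ge> 7"
      by linarith
    then show "(F * D) $ n = N $ n"
    proof cases
      case 8
      then show ?thesis
        unfolding L R rec[OF 8] by simp
    qed (unfold L R, simp_all add: r0 r1[unfolded One_nat_def] r2[unfolded One_nat_def] r3 r4 r5 r6
        algebra_simps power_numeral_reduce)
  qed
  \<comment> \<open>The constant coefficient of \<open>D\<close> is 1; this licenses cancelling
    \<open>D\<close> in \<open>F * D = N\<close>.\<close>
  moreover have "D \<noteq> 0"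
  proof
    assume "D = 0"
    then have "D $ 0 = 0" by simp
    then show False by (simp add: D_def)
  qed
  ultimately have "F = N / D"
    by (metis nonzero_mult_div_cancel_right)
  then show ?thesis
    by (simp add: F_def N_def D_def X_def Let_def fps_const_power
        flip: fps_const_add fps_const_1_eq_1)
qed

end
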